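(* Let $X=\ell_2$ (real), $Z=X\oplus_2 X$ and $A=\{(x,0)\in Z: x\in X\}$. Then there exist a closed subspace $B$ of $Z$ with $A\cap B=\{0\}$, a point $z_0\in Z$, and two sequences $\{A_n\},\{B_n\}$ of nonempty closed convex subsets of $Z$ converging for the Attouch-Wets convergence to $A$ and $B$, respectively, such that the perturbed alternating projections sequences $\{a_n\}$ and $\{b_n\}$ (with respect to $\{A_n\}$ and $\{B_n\}$ and with starting point $z_0$) are unbounded.
   Context: $X\oplus_2X$ is the Hilbert space $X\times X$ with norm $\|(x,y)\|=(\|x\|^2+\|y\|^2)^{1/2}$. For a nonempty closed convex set $K\subset Z$, $P_K$ denotes the metric projection onto $K$. Perturbed alternating projections sequences: given a starting point $a_0\in Z$ and sequences $\{A_n\},\{B_n\}$ of nonempty closed convex sets, they are defined inductively by $b_n=P_{B_n}(a_{n-1})$ and $a_n=P_{A_n}(b_n)$ for $n\in\mathbb{N}=\{1,2,\dots\}$. Attouch-Wets convergence: let $B_Z$ be the closed unit ball of $Z$. For nonempty closed $E,C\subset Z$ and $N\in\mathbb{N}$ put $e_N(E,C)=\sup\{\mathrm{dist}(a,C): a\in E,\ \|a\|\le N\}$ (equal to $0$ if $E\cap NB_Z=\emptyset$) and $h_N(E,C)=\max\{e_N(E,C),e_N(C,E)\}$. A sequence $\{E_n\}$ of nonempty closed sets Attouch-Wets converges to the nonempty closed set $E$ if $\lim_n h_N(E_n,E)=0$ for every $N\in\mathbb{N}$. *)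

theory Defs
  imports "HOL-Analysis.Analysis"
begin

subsection \<open>The real Hilbert space of square-summable sequences\<close>

typedef ell2 = "{f :: nat \<Rightarrow> real. summable (\<lambda>i. (f i)\<^sup>2)}"
  morphisms coord Abs_ell2
  by (rule exI [of _ "\<lambda>_. 0"]) simp

setup_lifting type_definition_ell2

lemma summable_coord_square: "summable (\<lambda>i. (coord x i)\<^sup>2)"
  using coord [of x] by simp

lemma summable_mult_of_squares:
  fixes f g :: "nat \<Rightarrow> real"
  assumes "summable (\<lambda>i. (f i)\<^sup>2)" "summable (\<lambda>i. (g i)\<^sup>2)"
  shows "summable (\<lambda>i. f i * g i)"
proof (rule summable_comparison_test' [of _ 0])
  show "summable (\<lambda>i. (f i)\<^sup>2 + (g i)\<^sup>2)"
    by (rule summable_add [OF assms])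
next
  fix i :: nat
  have "0 \<le> (\<bar>f i\<bar> - \<bar>g i\<bar>)\<^sup>2" "0 \<le> \<bar>f i\<bar> * \<bar>g i\<bar>"
    by simp_all
  then show "norm (f i * g i) \<le> (f i)\<^sup>2 + (g i)\<^sup>2"
    unfolding real_norm_def abs_mult power2_diff power2_abs by linarith
qed

lemma summable_coord_mult: "summable (\<lambda>i. coord x i * coord y i)"
  by (rule summable_mult_of_squares) (rule summable_coord_square)+

lemma summable_square_add:
  fixes f g :: "nat \<Rightarrow> real"
  assumes "summable (\<lambda>i. (f i)\<^sup>2)" "summable (\<lambda>i. (g i)\<^sup>2)"
  shows "summable (\<lambda>i. (f i + g i)\<^sup>2)"
  using summable_add [OF summable_add [OF assms]
      summable_mult [OF summable_mult_of_squares [OF assms], of 2]]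
  by (simp add: power2_sum algebra_simps)

instantiation ell2 :: real_inner
begin

lift_definition zero_ell2 :: ell2 is "\<lambda>_. 0"
  by simp

lift_definition plus_ell2 :: "ell2 \<Rightarrow> ell2 \<Rightarrow> ell2" is "\<lambda>f g i. f i + g i"
  by (rule summable_square_add)

lift_definition uminus_ell2 :: "ell2 \<Rightarrow> ell2" is "\<lambda>f i. - f i"
  by simp

lift_definition minus_ell2 :: "ell2 \<Rightarrow> ell2 \<Rightarrow> ell2" is "\<lambda>f g i. f i - g i"
  using summable_square_add [of _ "\<lambda>i. - _ i"] by simp

lift_definition scaleR_ell2 :: "real \<Rightarrow> ell2 \<Rightarrow> ell2" is "\<lambda>r f i. r * f i"
  by (simp add: power_mult_distrib summable_mult)

lift_definition inner_ell2 :: "ell2 \<Rightarrow> ell2 \<Rightarrow> real" is "\<lambda>f g. \<Sum>i. f i * g i" .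

definition norm_ell2 :: "ell2 \<Rightarrow> real" where
  "norm_ell2 x = sqrt (inner x x)"

definition dist_ell2 :: "ell2 \<Rightarrow> ell2 \<Rightarrow> real" where
  "dist_ell2 x y = norm (x - y)"

definition sgn_ell2 :: "ell2 \<Rightarrow> ell2" where
  "sgn_ell2 x = scaleR (inverse (norm x)) x"

definition uniformity_ell2 :: "(ell2 \<times> ell2) filter" where
  "uniformity_ell2 = (INF e\<in>{0<..}. principal {(x, y). dist x y < e})"

definition open_ell2 :: "ell2 set \<Rightarrow> bool" where
  "open_ell2 U \<longleftrightarrow> (\<forall>x\<in>U. eventually (\<lambda>(x', y). x' = x \<longrightarrow> y \<in> U) uniformity)"

instance
proof
  fix x y z :: ell2 and r s :: real and U :: "ell2 set"
  show "x + y + z = x + (y + z)" "x + y = y + x" "0 + x = x" "- x + x = 0" "x - y = x + - y"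
    by (transfer, simp add: fun_eq_iff)+
  show "r *\<^sub>R (x + y) = r *\<^sub>R x + r *\<^sub>R y" "(r + s) *\<^sub>R x = r *\<^sub>R x + s *\<^sub>R x"
       "r *\<^sub>R s *\<^sub>R x = (r * s) *\<^sub>R x" "1 *\<^sub>R x = x"
    by (transfer, simp add: fun_eq_iff algebra_simps)+
  show "sgn x = scaleR (inverse (norm x)) x" "dist x y = norm (x - y)" "norm x = sqrt (inner x x)"
       "uniformity = (INF e\<in>{0<..}. principal {(x :: ell2, y). dist x y < e})"
       "open U = (\<forall>x\<in>U. \<forall>\<^sub>F (x', y) in uniformity. x' = x \<longrightarrow> y \<in> U)"
    by (simp_all only: sgn_ell2_def dist_ell2_def norm_ell2_def uniformity_ell2_def open_ell2_def)
  show "inner x y = inner y x"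
    by transfer (simp add: mult.commute)
  show "inner (x + y) z = inner x z + inner y z"
    by transfer (simp add: ring_distribs suminf_add [symmetric] summable_mult_of_squares)
  show "inner (r *\<^sub>R x) y = r * inner x y"
    by transfer (simp add: mult.assoc suminf_mult summable_mult_of_squares)
  show "0 \<le> inner x x"
    by transfer (simp add: suminf_nonneg flip: power2_eq_square)
  show "inner x x = 0 \<longleftrightarrow> x = 0"
    by transfer (simp add: suminf_eq_zero_iff fun_eq_iff flip: power2_eq_square)
qed

end

lemma norm_ell2_square: "(norm x)\<^sup>2 = (\<Sum>i. (coord x i)\<^sup>2)"
  unfolding power2_norm_eq_inner
  by (simp add: inner_ell2.rep_eq power2_eq_square)

lemma partial_sum_le_norm_ell2: "(\<Sum>i<k. (coord x i)\<^sup>2) \<le> (norm x)\<^sup>2"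
  unfolding norm_ell2_square by (rule sum_le_suminf) (simp_all add: summable_coord_square)

lemma abs_coord_le_norm_ell2: "\<bar>coord x i\<bar> \<le> norm x"
proof -
  have "(coord x i)\<^sup>2 \<le> (\<Sum>j<Suc i. (coord x j)\<^sup>2)"
    by (simp add: sum_nonneg)
  also have "\<dots> \<le> (norm x)\<^sup>2"
    by (rule partial_sum_le_norm_ell2)
  finally show ?thesis
    by (metis abs_le_square_iff abs_norm_cancel)
qed

instance ell2 :: complete_space
proof
  fix X :: "nat \<Rightarrow> ell2"
  assume X: "Cauchy X"
  have "Cauchy (\<lambda>n. coord (X n) i)" for i
  proof (rule metric_CauchyI)
    fix e :: real
    assume "0 < e"
    with X obtain M where "dist (X m) (X n) < e" if "m \<ge> M" "n \<ge> M" for m n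
      by (meson metric_CauchyD)
    moreover have "dist (coord (X m) i) (coord (X n) i) \<le> dist (X m) (X n)" for m n
      using abs_coord_le_norm_ell2 [of "X m - X n" i]
      by (simp add: dist_norm minus_ell2.rep_eq)
    ultimately show "\<exists>M. \<forall>m\<ge>M. \<forall>n\<ge>M. dist (coord (X m) i) (coord (X n) i) < e"
      by (meson le_less_trans)
  qed
  then have "\<forall>i. \<exists>l. (\<lambda>n. coord (X n) i) \<longlonglongrightarrow> l"
    using Cauchy_convergent_iff convergent_def by blast
  then obtain L where L: "\<And>i. (\<lambda>n. coord (X n) i) \<longlonglongrightarrow> L i"
    by metis
  have tail: "\<exists>M. \<forall>m\<ge>M. \<forall>k. (\<Sum>i<k. (coord (X m) i - L i)\<^sup>2) \<le> e\<^sup>2" if "0 < e" for e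
  proof -
    obtain M where M: "dist (X m) (X n) < e" if "m \<ge> M" "n \<ge> M" for m n
      using metric_CauchyD [OF X \<open>0 < e\<close>] by meson
    have "(\<Sum>i<k. (coord (X m) i - L i)\<^sup>2) \<le> e\<^sup>2" if "m \<ge> M" for m k
    proof (rule LIMSEQ_le_const2)
      show "(\<lambda>n. \<Sum>i<k. (coord (X m) i - coord (X n) i)\<^sup>2)
              \<longlonglongrightarrow> (\<Sum>i<k. (coord (X m) i - L i)\<^sup>2)"
        by (intro tendsto_intros L)
      have "(\<Sum>i<k. (coord (X m) i - coord (X n) i)\<^sup>2) \<le> e\<^sup>2" if "n \<ge> M" for n
      proof -
        have "(\<Sum>i<k. (coord (X m) i - coord (X n) i)\<^sup>2) \<le> (norm (X m - X n))\<^sup>2"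
          using partial_sum_le_norm_ell2 [of "X m - X n" k] by (simp add: minus_ell2.rep_eq)
        also have "\<dots> \<le> e\<^sup>2"
          using M [OF \<open>m \<ge> M\<close> \<open>n \<ge> M\<close>] by (simp add: dist_norm power_mono)
        finally show ?thesis .
      qed
      then show "\<exists>N. \<forall>n\<ge>N. (\<Sum>i<k. (coord (X m) i - coord (X n) i)\<^sup>2) \<le> e\<^sup>2"
        by blast
    qed
    then show ?thesis
      by blast
  qed
  have diff: "summable (\<lambda>i. (coord (X m) i - L i)\<^sup>2)"
    if "\<forall>k. (\<Sum>i<k. (coord (X m) i - L i)\<^sup>2) \<le> c" for m c
    using that by (intro summableI_nonneg_bounded [where x = c]) simp_all
  obtain m where m: "summable (\<lambda>i. (coord (X m) i - L i)\<^sup>2)"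
    using tail [OF zero_less_one] diff by blast
  have "summable (\<lambda>i. (L i - coord (X m) i + coord (X m) i)\<^sup>2)"
    using m by (intro summable_square_add summable_coord_square) (simp add: power2_commute)
  then have L_ell2: "coord (Abs_ell2 L) = L"
    by (simp add: Abs_ell2_inverse)
  have "X \<longlonglongrightarrow> Abs_ell2 L"
  proof (rule metric_LIMSEQ_I)
    fix e :: real
    assume "0 < e"
    then obtain M where M: "\<forall>m\<ge>M. \<forall>k. (\<Sum>i<k. (coord (X m) i - L i)\<^sup>2) \<le> (e / 2)\<^sup>2"
      using tail [of "e / 2"] by auto
    have "dist (X n) (Abs_ell2 L) < e" if "n \<ge> M" for n
    proof -
      have "(norm (X n - Abs_ell2 L))\<^sup>2 \<le> (e / 2)\<^sup>2"
        unfolding norm_ell2_square minus_ell2.rep_eq L_ell2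
      proof (rule suminf_le_const)
        show partial: "(\<Sum>i<k. (coord (X n) i - L i)\<^sup>2) \<le> (e / 2)\<^sup>2" for k
          using M that by blast
        show "summable (\<lambda>i. (coord (X n) i - L i)\<^sup>2)"
          using partial by (intro diff allI)
      qed
      then have "norm (X n - Abs_ell2 L) \<le> e / 2"
        using \<open>0 < e\<close> by (auto intro: power2_le_imp_le)
      then show ?thesis
        using \<open>0 < e\<close> by (simp add: dist_norm)
    qed
    then show "\<exists>M. \<forall>n\<ge>M. dist (X n) (Abs_ell2 L) < e"
      by blast
  qed
  then show "convergent X"
    by (auto simp: convergent_def)
qed

instance ell2 :: banach ..


subsection \<open>Metric projections and perturbed alternating projections\<close>

text \<open>The library's \<open>closest_point\<close> requires \<^class>\<open>heine_borel\<close>, which fails in infinite dimension.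
  The nearest point exists and is unique for nonempty closed convex \<open>K\<close> in a Hilbert space.\<close>

definition metric_projection :: "'a::metric_space set \<Rightarrow> 'a \<Rightarrow> 'a" where
  "metric_projection K x = (THE y. y \<in> K \<and> (\<forall>z\<in>K. dist x y \<le> dist x z))"

text \<open>The sets are indexed from 1; \<open>A 0\<close>, \<open>B 0\<close> are never used, and
  \<open>perturbed_proj_b A B z0 n\<close> is meaningful for \<open>n \<ge> 1\<close> only.\<close>

primrec perturbed_proj_a ::
    "(nat \<Rightarrow> 'a::metric_space set) \<Rightarrow> (nat \<Rightarrow> 'a set) \<Rightarrow> 'a \<Rightarrow> nat \<Rightarrow> 'a" where
  "perturbed_proj_a A B z0 0 = z0"
| "perturbed_proj_a A B z0 (Suc n) =
     metric_projection (A (Suc n)) (metric_projection (B (Suc n)) (perturbed_proj_a A B z0 n))"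

definition perturbed_proj_b ::
    "(nat \<Rightarrow> 'a::metric_space set) \<Rightarrow> (nat \<Rightarrow> 'a set) \<Rightarrow> 'a \<Rightarrow> nat \<Rightarrow> 'a" where
  "perturbed_proj_b A B z0 n = metric_projection (B n) (perturbed_proj_a A B z0 (n - 1))"

lemma perturbed_proj_a_eq:
  "n \<ge> 1 \<Longrightarrow> perturbed_proj_a A B z0 n = metric_projection (A n) (perturbed_proj_b A B z0 n)"
  by (cases n) (simp_all add: perturbed_proj_b_def)


subsection \<open>Attouch--Wets convergence\<close>

text \<open>For nonempty \<open>C\<close> the supremum below is over a set bounded by \<open>N + infdist 0 C\<close>, so the
  real-valued \<open>SUP\<close> is the true supremum.\<close>

definition aw_excess :: "nat \<Rightarrow> 'a::real_normed_vector set \<Rightarrow> 'a set \<Rightarrow> real" where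
  "aw_excess N E C =
     (if E \<inter> cball 0 (real N) = {} then 0 else (SUP a\<in>E \<inter> cball 0 (real N). infdist a C))"

definition aw_dist :: "nat \<Rightarrow> 'a::real_normed_vector set \<Rightarrow> 'a set \<Rightarrow> real" where
  "aw_dist N E C = max (aw_excess N E C) (aw_excess N C E)"

definition attouch_wets_converges ::
    "(nat \<Rightarrow> 'a::real_normed_vector set) \<Rightarrow> 'a set \<Rightarrow> bool" where
  "attouch_wets_converges E_seq E \<longleftrightarrow> (\<forall>N\<ge>1. (\<lambda>n. aw_dist N (E_seq n) E) \<longlonglongrightarrow> 0)"

end

theory Submission
  imports Defs "HOL-Library.Discrete_Functions"
begin

text \<open>
  Let \<open>B\<close> be the graph \<open>{(x, D x)}\<close> of a diagonal operator \<open>D\<close> with positive entries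
  \<open>\<delta> k\<close> tending to \<open>0\<close>, so that \<open>A \<inter> B = {0}\<close> although \<open>B\<close> contains lines at arbitrarily small
  angles to \<open>A\<close>.
  Keep \<open>A\<^sub>n = A\<close> and let \<open>B\<^sub>n\<close> be the translate of \<open>B\<close> by \<open>(0, -c\<^sub>n)\<close>. Such translates converge
  to \<open>B\<close> in the Attouch-Wets sense as soon as \<open>c\<^sub>n\<close> tends to \<open>0\<close>
  (\<open>attouch_wets_converges_translation\<close>).

  Both projections are explicit (\<open>metric_projection_translated_graph\<close>,
  \<open>metric_projection_axis\<close>): one round, \<open>P\<^sub>B\<close> and then \<open>P\<^sub>A\<close>, acts on the first component coordinatewise
  by \<open>t \<mapsto> (t + \<delta> i * c i) / (1 + (\<delta> i)\<^sup>2)\<close>, whose fixed point \<open>c i / \<delta> i\<close> is the abscissa at which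
  the \<open>i\<close>-th line of \<open>B\<close>, lowered by \<open>c i\<close>, meets the axis. If \<open>c\<close> is \<open>\<epsilon> k\<close> times the \<open>k\<close>-th
  unit vector and is kept for \<open>1 / (\<delta> k)\<^sup>2\<close> rounds, the \<open>k\<close>-th coordinate, never negative on the orbit of \<open>0\<close>,
  reaches at least half of \<open>\<epsilon> k / \<delta> k\<close> (\<open>relaxation_to_fixed_point\<close>). With \<open>(\<delta> k)\<^sup>2 = 1 / 2 ^ k\<close> and
  \<open>\<epsilon> k = sqrt (\<delta> k)\<close> the shifts tend to \<open>0\<close> while \<open>\<epsilon> k / \<delta> k = 1 / \<epsilon> k\<close> tends to infinity, and
  the dyadic block \<open>2 ^ k \<le> n < 2 ^ Suc k\<close> gives the \<open>k\<close>-th coordinate exactly the rounds it needs.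
\<close>

section \<open>Coordinates, diagonal operators and multiples of unit vectors\<close>

lemma ell2_eqI: "(\<And>i. coord x i = coord y i) \<Longrightarrow> x = y"
  by (rule coord_inject [THEN iffD1]) (rule ext)

lemma bounded_linear_coord: "bounded_linear (\<lambda>x. coord x i)"
  by (rule bounded_linear_intro [where K = 1])
     (simp_all add: plus_ell2.rep_eq scaleR_ell2.rep_eq abs_coord_le_norm_ell2)

text \<open>The diagonal operator with entries \<open>f i\<close>; it is used only when \<open>\<bar>f i\<bar> \<le> 1\<close> for all \<open>i\<close>.\<close>

definition diag_op :: "(nat \<Rightarrow> real) \<Rightarrow> ell2 \<Rightarrow> ell2" where
  "diag_op f x = Abs_ell2 (\<lambda>i. f i * coord x i)"

lemma coord_diag_op:
  assumes "\<And>i. \<bar>f i\<bar> \<le> 1"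
  shows "coord (diag_op f x) i = f i * coord x i"
proof -
  have "summable (\<lambda>i. (f i * coord x i)\<^sup>2)"
  proof (rule summable_comparison_test' [OF summable_coord_square [of x], of 0])
    show "norm ((f i * coord x i)\<^sup>2) \<le> (coord x i)\<^sup>2" for i
      using mult_right_mono [of "(f i)\<^sup>2" 1 "(coord x i)\<^sup>2"] assms [of i]
      by (simp add: power_mult_distrib abs_square_le_1)
  qed
  then show ?thesis
    by (simp add: diag_op_def Abs_ell2_inverse)
qed

lemma inner_diag_op:
  assumes "\<And>i. \<bar>f i\<bar> \<le> 1"
  shows "inner (diag_op f x) y = inner x (diag_op f y)"
  by (simp add: inner_ell2.rep_eq coord_diag_op [OF assms] mult_ac)

text \<open>The \<open>k\<close>-th unit vector multiplied by \<open>t\<close>.\<close>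

definition single_ell2 :: "nat \<Rightarrow> real \<Rightarrow> ell2" where
  "single_ell2 k t = Abs_ell2 (\<lambda>i. if i = k then t else 0)"

lemma coord_single_ell2: "coord (single_ell2 k t) i = (if i = k then t else 0)"
proof -
  have "summable (\<lambda>i. (if i = k then t else 0)\<^sup>2)"
    by (rule summable_finite [of "{k}"]) auto
  then show ?thesis
    by (simp add: single_ell2_def Abs_ell2_inverse)
qed

lemma norm_single_ell2: "norm (single_ell2 k t) = \<bar>t\<bar>"
proof -
  have "(norm (single_ell2 k t))\<^sup>2 = (\<Sum>i\<in>{k}. (coord (single_ell2 k t) i)\<^sup>2)"
    unfolding norm_ell2_square by (rule suminf_finite) (simp_all add: coord_single_ell2)
  then have "(norm (single_ell2 k t))\<^sup>2 = \<bar>t\<bar>\<^sup>2"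
    by (simp add: coord_single_ell2)
  then show ?thesis
    by (rule power2_eq_imp_eq) simp_all
qed

section \<open>Attouch-Wets convergence of translates\<close>

lemma aw_excess_bounds:
  assumes "\<And>a. a \<in> E \<Longrightarrow> infdist a C \<le> r" and "0 \<le> r"
  shows "0 \<le> aw_excess N E C" "aw_excess N E C \<le> r"
proof -
  let ?S = "E \<inter> cball 0 (real N)"
  have bdd: "bdd_above ((\<lambda>a. infdist a C) ` ?S)"
    by (rule bdd_aboveI2 [of _ _ r]) (use assms(1) in blast)
  show "aw_excess N E C \<le> r"
    using assms by (auto simp: aw_excess_def intro!: cSUP_least)
  show "0 \<le> aw_excess N E C"
  proof (cases "?S = {}")
    case False
    then obtain a where "a \<in> ?S" by blast
    then have "0 \<le> (SUP a\<in>?S. infdist a C)"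
      by (rule cSUP_upper2 [OF bdd]) (rule infdist_nonneg)
    with False show ?thesis by (simp add: aw_excess_def)
  qed (simp add: aw_excess_def)
qed

lemma aw_dist_translation_bounds:
  "0 \<le> aw_dist N ((+) c ` E) E" "aw_dist N ((+) c ` E) E \<le> norm c"
proof -
  have 1: "infdist a E \<le> norm c" if "a \<in> (+) c ` E" for a
    using that by (auto intro!: infdist_le2 simp: dist_norm)
  have 2: "infdist a ((+) c ` E) \<le> norm c" if "a \<in> E" for a
    by (rule infdist_le2 [of "c + a"]) (use that in \<open>auto simp: dist_norm\<close>)
  show "0 \<le> aw_dist N ((+) c ` E) E" "aw_dist N ((+) c ` E) E \<le> norm c"
    using aw_excess_bounds [OF 1] aw_excess_bounds [OF 2]
    by (auto simp: aw_dist_def le_max_iff_disj)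
qed

lemma attouch_wets_converges_translation:
  assumes "c \<longlonglongrightarrow> 0"
  shows "attouch_wets_converges (\<lambda>n. (+) (c n) ` E) E"
  unfolding attouch_wets_converges_def
proof (intro allI impI)
  fix N :: nat
  show "(\<lambda>n. aw_dist N ((+) (c n) ` E) E) \<longlonglongrightarrow> 0"
    by (rule tendsto_sandwich [OF _ _ tendsto_const tendsto_norm_zero [OF assms]])
       (simp_all add: aw_dist_translation_bounds)
qed

section \<open>The two projections\<close>

text \<open>Orthogonality to all differences, rather than an obtuse angle, is enough here: the sets
  projected onto are affine subspaces.\<close>

lemma metric_projection_eqI:
  fixes x y :: "'a::real_inner"
  assumes "y \<in> K" and orth: "\<And>z. z \<in> K \<Longrightarrow> inner (x - y) (z - y) = 0"
  shows "metric_projection K x = y"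
  unfolding metric_projection_def
proof (rule the_equality)
  have pyth: "(dist x z)\<^sup>2 = (dist x y)\<^sup>2 + (dist y z)\<^sup>2" if "z \<in> K" for z
  proof -
    have "inner (x - y) (y - z) = 0"
      using orth [OF that] by (simp add: inner_diff_right)
    from norm_add_Pythagorean [OF this [folded orthogonal_def]] show ?thesis
      by (simp add: dist_norm)
  qed
  show "y \<in> K \<and> (\<forall>z\<in>K. dist x y \<le> dist x z)"
  proof (intro conjI ballI)
    show "dist x y \<le> dist x z" if "z \<in> K" for z
      by (rule power2_le_imp_le) (simp_all add: pyth [OF that])
  qed (rule assms(1))
  fix w
  assume w: "w \<in> K \<and> (\<forall>z\<in>K. dist x w \<le> dist x z)"
  then have "(dist x w)\<^sup>2 \<le> (dist x y)\<^sup>2"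
    using assms(1) by (intro power_mono) auto
  moreover have "(dist x w)\<^sup>2 = (dist x y)\<^sup>2 + (dist y w)\<^sup>2"
    using w by (intro pyth) simp
  ultimately have "(dist y w)\<^sup>2 \<le> 0" by linarith
  then show "w = y" by simp
qed

lemma metric_projection_axis: "metric_projection {(x, 0) | x :: ell2. True} (u, v :: ell2) = (u, 0)"
  by (rule metric_projection_eqI) (auto simp: inner_prod_def)

text \<open>The first component \<open>u\<close> of the projection solves the normal equation
  \<open>(1 + D\<^sup>2) u = x + D c\<close>.\<close>

lemma metric_projection_translated_graph:
  assumes f: "\<And>i. \<bar>f i\<bar> \<le> 1"
    and u: "\<And>i. coord u i = (coord x i + f i * coord c i) / (1 + (f i)\<^sup>2)"
  shows "metric_projection ((+) (0, - c) ` range (\<lambda>v. (v, diag_op f v))) (x, 0) =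
           (u, diag_op f u - c)"
proof (rule metric_projection_eqI)
  show "(u, diag_op f u - c) \<in> (+) (0, - c) ` range (\<lambda>v. (v, diag_op f v))"
    by (auto simp: image_iff)
next
  fix z
  assume "z \<in> (+) (0, - c) ` range (\<lambda>v. (v, diag_op f v))"
  then obtain v where z: "z = (v, diag_op f v - c)" by auto
  have "diag_op f v - diag_op f u = diag_op f (v - u)"
    by (rule ell2_eqI) (simp add: coord_diag_op [OF f] minus_ell2.rep_eq algebra_simps)
  moreover have "x - u = diag_op f (diag_op f u - c)"
  proof (rule ell2_eqI)
    fix i
    have "1 + (f i)\<^sup>2 \<noteq> 0"
      by (metis add_pos_nonneg less_numeral_extra(3) zero_le_power2 zero_less_one)
    then have "coord u i * (1 + (f i)\<^sup>2) = coord x i + f i * coord c i"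
      by (simp add: u)
    then show "coord (x - u) i = coord (diag_op f (diag_op f u - c)) i"
      by (simp add: coord_diag_op [OF f] minus_ell2.rep_eq algebra_simps power2_eq_square)
  qed
  ultimately show "inner ((x, 0) - (u, diag_op f u - c)) (z - (u, diag_op f u - c)) = 0"
    by (simp add: z inner_diag_op [OF f] inner_diff_left inner_minus_left)
qed

text \<open>The orbit of a first component under alternating projections between the axis and
  translated graphs: a diagonal affine recursion.\<close>

lemma perturbed_proj_graph:
  fixes f :: "nat \<Rightarrow> real" and c :: "nat \<Rightarrow> ell2"
  defines "A \<equiv> \<lambda>n::nat. {(x, 0) | x :: ell2. True}"
    and "B \<equiv> \<lambda>n. (+) (0, - c n) ` range (\<lambda>v. (v, diag_op f v))"
  assumes f: "\<And>i. \<bar>f i\<bar> \<le> 1"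
  obtains u where
    "\<And>i. coord (u 0) i = 0"
    "\<And>n i. coord (u (Suc n)) i = (coord (u n) i + f i * coord (c (Suc n)) i) / (1 + (f i)\<^sup>2)"
    "\<And>n. perturbed_proj_a A B 0 n = (u n, 0)"
    "\<And>n. 1 \<le> n \<Longrightarrow> fst (perturbed_proj_b A B 0 n) = u n"
proof -
  define g where "g i = 1 / (1 + (f i)\<^sup>2)" for i
  have g: "\<bar>g i\<bar> \<le> 1" for i
  proof -
    have "0 < 1 + (f i)\<^sup>2" by (simp add: add_pos_nonneg)
    then show ?thesis by (simp add: g_def abs_of_nonneg)
  qed
  define u where "u = rec_nat 0 (\<lambda>n x. diag_op g (x + diag_op f (c (Suc n))))"
  have u_Suc: "coord (u (Suc n)) i =
      (coord (u n) i + f i * coord (c (Suc n)) i) / (1 + (f i)\<^sup>2)" for n i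
    by (simp add: u_def coord_diag_op [OF g] coord_diag_op [OF f] plus_ell2.rep_eq g_def)
  have proj_B: "metric_projection (B (Suc n)) (u n, 0) =
      (u (Suc n), diag_op f (u (Suc n)) - c (Suc n))" for n
    unfolding B_def by (rule metric_projection_translated_graph [OF f u_Suc])
  have a: "perturbed_proj_a A B 0 n = (u n, 0)" for n
  proof (induction n)
    case 0
    then show ?case by (simp add: u_def zero_prod_def)
  next
    case (Suc n)
    show ?case
      unfolding perturbed_proj_a.simps Suc.IH proj_B by (simp only: A_def metric_projection_axis)
  qed
  show thesis
  proof (rule that [OF _ u_Suc a])
    show "coord (u 0) i = 0" for i
      by (simp add: u_def zero_ell2.rep_eq)
    show "fst (perturbed_proj_b A B 0 n) = u n" if "1 \<le> n" for n
      using that by (cases n) (simp_all add: perturbed_proj_b_def a proj_B)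
  qed
qed

section \<open>The scalar recursion\<close>

text \<open>The map \<open>t \<mapsto> (t + (q - 1) * L) / q\<close> fixes \<open>L\<close> and divides the distance to \<open>L\<close> by \<open>q\<close>.\<close>

lemma relaxation_to_fixed_point:
  fixes v :: "nat \<Rightarrow> real"
  assumes "0 \<le> v 0" and q: "0 < q"
    and step: "\<And>j. j < m \<Longrightarrow> v (Suc j) = (v j + (q - 1) * L) / q"
    and "j \<le> m"
  shows "L * (1 - 1 / q ^ j) \<le> v j"
  using \<open>j \<le> m\<close>
proof (induction j)
  case 0
  then show ?case using assms(1) by simp
next
  case (Suc j)
  then have "L * (1 - 1 / q ^ j) + (q - 1) * L \<le> v j + (q - 1) * L" by simp
  then have "(L * (1 - 1 / q ^ j) + (q - 1) * L) / q \<le> v (Suc j)"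
    using q Suc.prems by (simp add: step divide_right_mono)
  moreover have "(L * (1 - 1 / q ^ j) + (q - 1) * L) / q = L * (1 - 1 / q ^ Suc j)"
    using q by (simp add: field_simps)
  ultimately show ?case by simp
qed

lemma filterlim_floor_log: "filterlim floor_log at_top sequentially"
  unfolding filterlim_at_top
proof
  fix k
  show "eventually (\<lambda>n. k \<le> floor_log n) sequentially"
    using eventually_ge_at_top [of "2 ^ k"]
    by eventually_elim (metis floor_log_power floor_log_mono monoD)
qed

section \<open>The unbounded orbit\<close>

theorem theorem5p7:
  fixes A :: "(ell2 \<times> ell2) set"
  assumes "A = {(x, 0) | x :: ell2. True}"
  shows "\<exists>(B :: (ell2 \<times> ell2) set) (z0 :: ell2 \<times> ell2)
            (A_seq :: nat \<Rightarrow> (ell2 \<times> ell2) set) (B_seq :: nat \<Rightarrow> (ell2 \<times> ell2) set).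
           subspace B \<and> closed B \<and> A \<inter> B = {0} \<and>
           (\<forall>n\<ge>1. A_seq n \<noteq> {} \<and> closed (A_seq n) \<and> convex (A_seq n)) \<and>
           (\<forall>n\<ge>1. B_seq n \<noteq> {} \<and> closed (B_seq n) \<and> convex (B_seq n)) \<and>
           attouch_wets_converges A_seq A \<and>
           attouch_wets_converges B_seq B \<and>
           \<not> bounded (perturbed_proj_a A_seq B_seq z0 ` {1..}) \<and>
           \<not> bounded (perturbed_proj_b A_seq B_seq z0 ` {1..})"
proof -
  define \<delta> :: "nat \<Rightarrow> real" where "\<delta> k = sqrt (1 / 2 ^ k)" for k
  define \<epsilon> where "\<epsilon> k = sqrt (\<delta> k)" for k
  define c where "c n = single_ell2 (floor_log n) (\<epsilon> (floor_log n))" for n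
  define B where "B = range (\<lambda>v. (v, diag_op \<delta> v))"
  define B_seq where "B_seq n = (+) (0, - c n) ` B" for n
  have \<delta>_pos: "0 < \<delta> k" and \<delta>_sq: "(\<delta> k)\<^sup>2 = 1 / 2 ^ k" for k
    by (simp_all add: \<delta>_def)
  have \<epsilon>_pos: "0 < \<epsilon> k" and \<epsilon>_sq: "\<epsilon> k * \<epsilon> k = \<delta> k" for k
    using \<delta>_pos [of k] by (simp_all add: \<epsilon>_def)
  have \<delta>_le: "\<bar>\<delta> k\<bar> \<le> 1" for k
    by (simp add: \<delta>_def)
  have "(\<lambda>k. (1 / 2 :: real) ^ k) \<longlonglongrightarrow> 0"
    by (rule LIMSEQ_power_zero) simp
  then have "\<delta> \<longlonglongrightarrow> 0"
    using tendsto_real_sqrt [of "\<lambda>k. (1 / 2) ^ k" 0] by (simp add: \<delta>_def [abs_def] power_one_over)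
  then have \<epsilon>_lim: "\<epsilon> \<longlonglongrightarrow> 0"
    using tendsto_real_sqrt [of \<delta> 0] by (simp add: \<epsilon>_def [abs_def])
  have "(\<lambda>n. norm (c n)) \<longlonglongrightarrow> 0"
    using filterlim_compose [OF \<epsilon>_lim filterlim_floor_log] \<epsilon>_pos
    by (simp add: c_def norm_single_ell2 less_imp_le)
  then have shift_lim: "(\<lambda>n. (0 :: ell2, - c n)) \<longlonglongrightarrow> 0"
    by (simp add: tendsto_norm_zero_iff [symmetric, of "\<lambda>n. (0 :: ell2, - c n)"])

  have coord_D: "coord (diag_op \<delta> v) i = \<delta> i * coord v i" for v i
    by (rule coord_diag_op [OF \<delta>_le])
  have mem_B: "p \<in> B \<longleftrightarrow> (\<forall>i. coord (snd p) i = \<delta> i * coord (fst p) i)" for p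
    unfolding B_def by (cases p) (auto simp: coord_D intro!: ell2_eqI image_eqI)
  have sub_B: "subspace B"
    by (rule subspaceI)
       (simp_all add: mem_B zero_ell2.rep_eq plus_ell2.rep_eq scaleR_ell2.rep_eq algebra_simps)
  have "closed {p. coord (snd p) i = \<delta> i * coord (fst p) i}" for i
    by (intro closed_Collect_eq continuous_intros
          bounded_linear.continuous_on [OF bounded_linear_coord])
  then have "closed {p. \<forall>i. coord (snd p) i = \<delta> i * coord (fst p) i}"
    by (rule closed_Collect_all)
  moreover have "B = {p. \<forall>i. coord (snd p) i = \<delta> i * coord (fst p) i}"
    using mem_B by blast
  ultimately have clo_B: "closed B" by simp
  have A_B: "A \<inter> B = {0}"
  proof -
    have "p = 0" if "p \<in> A" "p \<in> B" for p
    proof -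
      have "coord (fst p) i = 0" for i
        using that \<delta>_pos by (auto simp: assms mem_B zero_ell2.rep_eq less_le)
      then have "fst p = 0"
        by (intro ell2_eqI) (simp add: zero_ell2.rep_eq)
      with that show ?thesis by (auto simp: assms zero_prod_def)
    qed
    moreover have "0 \<in> A" "0 \<in> B"
      using subspace_0 [OF sub_B] by (auto simp: assms zero_prod_def)
    ultimately show ?thesis by blast
  qed
  have A_alt: "A = {p. snd p = 0}"
    by (auto simp: assms)
  have sub_A: "subspace A"
    by (rule subspaceI) (simp_all add: A_alt)
  have clo_A: "closed A"
    unfolding A_alt by (intro closed_Collect_eq continuous_intros)
  have aw_A: "attouch_wets_converges (\<lambda>n. A) A"
    using attouch_wets_converges_translation [of "\<lambda>n. 0" A] by simp
  have aw_B: "attouch_wets_converges B_seq B"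
    unfolding B_seq_def by (rule attouch_wets_converges_translation [OF shift_lim])

  obtain u where u_0: "\<And>i. coord (u 0) i = 0"
    and u_Suc: "\<And>n i. coord (u (Suc n)) i =
                  (coord (u n) i + \<delta> i * coord (c (Suc n)) i) / (1 + (\<delta> i)\<^sup>2)"
    and a: "\<And>n. perturbed_proj_a (\<lambda>n. A) B_seq 0 n = (u n, 0)"
    and b: "\<And>n. 1 \<le> n \<Longrightarrow> fst (perturbed_proj_b (\<lambda>n. A) B_seq 0 n) = u n"
    unfolding assms B_seq_def [abs_def] B_def
    by (rule perturbed_proj_graph [where f = \<delta> and c = c, OF \<delta>_le]) blast
  have u_nonneg: "0 \<le> coord (u n) i" for n i
  proof (induction n)
    case (Suc n)
    then show ?case
      using \<delta>_pos [of i] \<epsilon>_pos [of i]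
      by (auto simp: u_Suc c_def coord_single_ell2 intro!: divide_nonneg_nonneg)
  qed (simp add: u_0)
  have large: "1 / (2 * \<epsilon> k) \<le> norm (u (2 ^ Suc k - 1))" for k
  proof -
    define q where "q = 1 + (\<delta> k)\<^sup>2"
    \<comment> \<open>\<open>2 ^ k - 1\<close> rounds precede the block; its rounds have the numbers \<open>2 ^ k, \<dots>, 2 ^ Suc k - 1\<close>.\<close>
    define v where "v j = coord (u (2 ^ k - 1 + j)) k" for j
    have q: "0 < q" by (simp add: q_def add_pos_nonneg)
    have "v (Suc j) = (v j + (q - 1) * (1 / \<epsilon> k)) / q" if "j < 2 ^ k" for j
    proof -
      have "floor_log (Suc (2 ^ k - 1 + j)) = k"
        using that by (intro floor_log_eqI) auto
      moreover have "(q - 1) * (1 / \<epsilon> k) = \<delta> k * \<epsilon> k"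
        using \<epsilon>_pos [of k] by (simp add: q_def power2_eq_square flip: \<epsilon>_sq)
      ultimately show ?thesis
        unfolding v_def add_Suc_right u_Suc c_def coord_single_ell2 by (simp add: q_def)
    qed
    then have "1 / \<epsilon> k * (1 - 1 / q ^ (2 ^ k)) \<le> v (2 ^ k)"
      by (intro relaxation_to_fixed_point [OF _ q, of _ "2 ^ k"]) (auto simp: v_def u_nonneg)
    moreover have "- 1 \<le> (\<delta> k)\<^sup>2"
      by (rule order_trans [of _ 0]) simp_all
    \<comment> \<open>The block has \<open>2 ^ k = 1 / (\<delta> k)\<^sup>2\<close> rounds, just enough for the factor \<open>2\<close>.\<close>
    from Bernoulli_inequality [OF this, of "2 ^ k"] have "2 \<le> q ^ (2 ^ k)"
      by (simp add: q_def \<delta>_sq)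
    then have "1 / \<epsilon> k * (1 / 2) \<le> 1 / \<epsilon> k * (1 - 1 / q ^ (2 ^ k))"
      using \<epsilon>_pos [of k] by (intro mult_left_mono) (auto simp: field_simps)
    moreover have "v (2 ^ k) \<le> norm (u (2 ^ Suc k - 1))"
      using abs_coord_le_norm_ell2 [of "u (2 ^ Suc k - 1)" k]
      by (simp add: v_def mult_2)
    ultimately show ?thesis by simp
  qed
  have unbounded: "\<not> bounded (p ` {1..})"
    if "\<And>n. 1 \<le> n \<Longrightarrow> fst (p n) = u n" for p :: "nat \<Rightarrow> ell2 \<times> ell2"
  proof
    assume "bounded (p ` {1..})"
    then obtain M where M: "0 < M" "\<And>n. 1 \<le> n \<Longrightarrow> norm (p n) \<le> M"
      by (auto simp: bounded_pos)
    have "1 / (2 * M) \<le> \<epsilon> k" for k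
    proof -
      have *: "1 \<le> (2 :: nat) ^ Suc k - 1"
        using one_le_power [of "2 :: nat" k] unfolding power_Suc by linarith
      have "norm (u (2 ^ Suc k - 1)) \<le> norm (p (2 ^ Suc k - 1))"
        using norm_fst_le [of "fst (p (2 ^ Suc k - 1))" "snd (p (2 ^ Suc k - 1))"] that [OF *]
        by simp
      with large [of k] M(2) [OF *] have "1 / (2 * \<epsilon> k) \<le> M" by linarith
      with M(1) \<epsilon>_pos [of k] show ?thesis by (simp add: field_simps)
    qed
    then have "1 / (2 * M) \<le> 0"
      using LIMSEQ_le_const [OF \<epsilon>_lim] by blast
    with M(1) show False by simp
  qed
  show ?thesis
  proof (intro exI conjI allI impI)
    show "subspace B" "closed B" "A \<inter> B = {0}" "attouch_wets_converges B_seq B"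
      by fact+
    show "attouch_wets_converges (\<lambda>n. A) A" "closed A" by fact+
    show "A \<noteq> {}" "convex A"
      using A_B sub_A by (auto simp: subspace_imp_convex)
    show "B_seq n \<noteq> {}" "closed (B_seq n)" "convex (B_seq n)" for n
      using A_B clo_B sub_B
      by (auto simp: B_seq_def closed_translation convex_translation subspace_imp_convex)
    show "\<not> bounded (perturbed_proj_a (\<lambda>n. A) B_seq 0 ` {1..})"
      by (rule unbounded) (simp add: a)
    show "\<not> bounded (perturbed_proj_b (\<lambda>n. A) B_seq 0 ` {1..})"
      by (rule unbounded) (rule b)
  qed
qed

end
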